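(* Let $c\in\mathbb{C}\setminus\{0\}$ be such that $1+cz\neq 0$ for all $z\in\mathbb{R}$ and $(1+cz)^2-6c^2u\neq 0$ for all real $u\ge 0$ and all $z\in\mathbb{R}$ (for example, $c=\mathrm{i}$). Define, for real $u>0$ and $z\in\mathbb{R}$, $$\psi(u,z)=\frac23(1+cz)-\frac{\{(1+cz)^2-6c^2u\}^{3/2}}{3^3c^2u}+\frac{(1+cz)^3}{3^3c^2u},$$ where the power $3/2$ denotes the continuous branch on $\{(u,z):u\geq 0,\ z\in\mathbb{R}\}$ which takes the value $1$ at $(u,z)=(0,0)$. Then the singularity of $\psi$ at $u=0$ is removable, and the map $$\phi(x,y,z)=(x+\mathrm{i}y)\,\psi\!\left(\tfrac{x^2+y^2}{2},z\right)$$ is (real-)analytic on all of $\mathbb{R}^3$, is semi-conformal, and is not harmonic.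
   Context: A differentiable map $\phi:\mathbb{R}^3\to\mathbb{C}$ is semi-conformal if $\left(\frac{\partial\phi}{\partial x}\right)^2+\left(\frac{\partial\phi}{\partial y}\right)^2+\left(\frac{\partial\phi}{\partial z}\right)^2=0$ everywhere (equivalently, the gradients of its real and imaginary parts are everywhere orthogonal and of equal length). It is harmonic if $\frac{\partial^2\phi}{\partial x^2}+\frac{\partial^2\phi}{\partial y^2}+\frac{\partial^2\phi}{\partial z^2}=0$ everywhere. *)

theory Defs
  imports "HOL-Analysis.Analysis"
begin

text \<open>
  Real-analyticity: around every point of \<open>S\<close> the function is the sum of a power series in the
  coordinate increments. Multi-indices are the functions \<open>Basis \<rightarrow> nat\<close>, and \<open>has_sum\<close> is
  unconditional summation over them. The expansion is required on a full ball, so analyticity on a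
  set that is not open means analyticity on some neighbourhood of it.
\<close>

definition real_analytic_on ::
    "('a::euclidean_space \<Rightarrow> 'b::real_normed_vector) \<Rightarrow> 'a set \<Rightarrow> bool"
    (infixl \<open>(real'_analytic'_on)\<close> 50) where
  "f real_analytic_on S \<longleftrightarrow>
     (\<forall>p\<in>S. \<exists>r>0. \<exists>a :: ('a \<Rightarrow> nat) \<Rightarrow> 'b. \<forall>q\<in>ball p r.
        ((\<lambda>k. (\<Prod>b\<in>Basis. ((q - p) \<bullet> b) ^ k b) *\<^sub>R a k) has_sum f q)
          (Basis \<rightarrow>\<^sub>E (UNIV :: nat set)))"

definition partial_deriv :: "'n::finite \<Rightarrow> (real ^ 'n \<Rightarrow> complex) \<Rightarrow> real ^ 'n \<Rightarrow> complex" where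
  "partial_deriv i f p = vector_derivative (\<lambda>t. f (p + t *\<^sub>R axis i 1)) (at 0)"

definition semi_conformal :: "(real ^ 3 \<Rightarrow> complex) \<Rightarrow> bool" where
  "semi_conformal f \<longleftrightarrow>
     f differentiable_on UNIV \<and>
     (\<forall>p. (partial_deriv 1 f p)\<^sup>2 + (partial_deriv 2 f p)\<^sup>2 + (partial_deriv 3 f p)\<^sup>2 = 0)"

text \<open>
  No regularity is built in: \<open>vector_derivative\<close> is unspecified where the derivative does not exist,
  so the predicate is meant for twice differentiable functions only.
\<close>

definition harmonic :: "(real ^ 3 \<Rightarrow> complex) \<Rightarrow> bool" where
  "harmonic f \<longleftrightarrow>
     (\<forall>p. partial_deriv 1 (partial_deriv 1 f) p + partial_deriv 2 (partial_deriv 2 f) p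
        + partial_deriv 3 (partial_deriv 3 f) p = 0)"

text \<open>
  A continuous branch on \<open>D\<close> of the multivalued power \<open>F\<^sup>a\<close>: the values of \<open>w\<^sup>a\<close> are the numbers
  \<open>exp (a l)\<close> with \<open>l\<close> any logarithm of \<open>w\<close>. (The library's \<open>powr\<close> is the principal value, which is
  discontinuous across the negative axis.)
\<close>

definition continuous_power_branch ::
    "complex \<Rightarrow> ('a::topological_space \<Rightarrow> complex) \<Rightarrow> 'a set \<Rightarrow> ('a \<Rightarrow> complex) \<Rightarrow> bool" where
  "continuous_power_branch a F D B \<longleftrightarrow>
     continuous_on D B \<and> (\<forall>p\<in>D. \<exists>l. exp l = F p \<and> B p = exp (a * l))"

text \<open>Points of the half-plane are pairs \<open>(u, z)\<close>.\<close>

definition half_plane :: "(real \<times> real) set" where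
  "half_plane = {(u, z). u \<ge> 0}"

definition radicand :: "complex \<Rightarrow> real \<times> real \<Rightarrow> complex" where
  "radicand c = (\<lambda>(u, z). (1 + c * of_real z)\<^sup>2 - 6 * c\<^sup>2 * of_real u)"

definition is_branch :: "complex \<Rightarrow> (real \<times> real \<Rightarrow> complex) \<Rightarrow> bool" where
  "is_branch c B \<longleftrightarrow> continuous_power_branch (3 / 2) (radicand c) half_plane B \<and> B (0, 0) = 1"

text \<open>\<open>B\<close> stands for the chosen branch of the \<open>3/2\<close>-th power of the radicand.\<close>

definition psi ::
    "complex \<Rightarrow> (real \<times> real \<Rightarrow> complex) \<Rightarrow> real \<times> real \<Rightarrow> complex" where
  "psi c B = (\<lambda>(u, z).
     2 / 3 * (1 + c * of_real z)
     - B (u, z) / (3 ^ 3 * c\<^sup>2 * of_real u)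
     + (1 + c * of_real z) ^ 3 / (3 ^ 3 * c\<^sup>2 * of_real u))"

definition phi :: "(real \<times> real \<Rightarrow> complex) \<Rightarrow> real ^ 3 \<Rightarrow> complex" where
  "phi \<Psi> p =
     (of_real (p $ 1) + \<i> * of_real (p $ 2)) * \<Psi> (((p $ 1)\<^sup>2 + (p $ 2)\<^sup>2) / 2, p $ 3)"

lemma ii_satisfies_hypotheses:
  shows "\<i> \<noteq> 0"
    and "1 + \<i> * complex_of_real z \<noteq> 0"
    and "u \<ge> 0 \<Longrightarrow> (1 + \<i> * complex_of_real z)\<^sup>2 - 6 * \<i>\<^sup>2 * complex_of_real u \<noteq> 0"
proof -
  show "\<i> \<noteq> 0" by simp
  show "1 + \<i> * complex_of_real z \<noteq> 0" by (simp add: complex_eq_iff)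
  show "(1 + \<i> * complex_of_real z)\<^sup>2 - 6 * \<i>\<^sup>2 * complex_of_real u \<noteq> 0" if "u \<ge> 0"
    using that by (auto simp: complex_eq_iff power2_eq_square)
qed

end

theory Submission
  imports Defs "HOL-Complex_Analysis.Cauchy_Integral_Formula"
begin

text \<open>
  Write \<open>\<omega> = 1 + c z\<close>. The radicand is \<open>\<omega>\<^sup>2 (1 - t)\<close> with \<open>t = 6 c\<^sup>2 u / \<omega>\<^sup>2\<close>. For fixed \<open>z\<close>
  and \<open>u\<close> running through the nonnegative reals, \<open>t\<close> runs through a ray from \<open>0\<close>, and the hypothesis
  says that no such ray contains \<open>1\<close>. So \<open>1 - t\<close> never meets the negative axis, the principal root
  applies to it, and \<open>\<sigma> = \<omega> csqrt (1 - t)\<close> is a continuous square root of the radicand with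
  \<open>\<sigma> = 1\<close> at the origin. Hence \<open>\<sigma>\<^sup>3\<close> is the required branch; two branches have the same square,
  the cube of the radicand, and so agree on the connected half-plane.

  Since \<open>\<omega>\<^sup>2 - \<sigma>\<^sup>2 = 6 c\<^sup>2 u\<close>, the quotient \<open>(\<omega>\<^sup>3 - \<sigma>\<^sup>3) / (27 c\<^sup>2 u)\<close> loses its denominator, and
  \<open>\<psi> = (2/9) (2 \<omega> + \<sigma>)\<^sup>2 / (\<omega> + \<sigma>)\<close> (lemma \<open>profile_eq_psi\<close>). Here \<open>\<omega> + \<sigma>\<close> has no zero, because
  \<open>\<sigma> / \<omega>\<close> is a principal root and has positive real part. This formula is built from coordinates by
  sums, products and holomorphic functions of one variable, so analyticity of \<open>\<psi>\<close> and of \<open>\<phi>\<close>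
  follows once power series in several variables are closed under these operations. That closure is
  proved by majorants: for series that converge absolutely at the corner of a cube, the sum of the
  absolute values at that corner is a submultiplicative norm
  (lemmas \<open>expands_mult\<close>, \<open>expands_has_sum\<close>, \<open>expandable_holomorphic_compose\<close>).

  For the differential equations put \<open>\<zeta> = x + \<i> y\<close> and \<open>\<kappa> = (2 \<omega> + \<sigma>) / (\<omega> + \<sigma>)\<^sup>2\<close>. Differentiating
  \<open>\<sigma>\<^sup>2 = \<omega>\<^sup>2 - 3 c\<^sup>2 (x\<^sup>2 + y\<^sup>2)\<close> gives the gradient of \<open>\<phi> = \<zeta> \<psi>\<close> as
  \<open>(\<psi> - (2/3) c\<^sup>2 x \<zeta> \<kappa>, \<i> \<psi> - (2/3) c\<^sup>2 y \<zeta> \<kappa>, (2/3) c \<zeta> \<kappa> (\<omega> + \<sigma>))\<close>. As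
  \<open>\<psi> = (2/9) \<kappa> (2 \<omega> + \<sigma>) (\<omega> + \<sigma>)\<close>, the sum of the squares is \<open>(4/27) c\<^sup>2 \<zeta>\<^sup>2 \<kappa>\<^sup>2\<close> times
  \<open>(\<omega> - \<sigma>) (\<omega> + \<sigma>) + 3 (\<omega> + \<sigma>)\<^sup>2 - 2 (2 \<omega> + \<sigma>) (\<omega> + \<sigma>) = 0\<close>. At the point \<open>(1, 0, 0)\<close> the
  Laplacian is \<open>- (4/3) c\<^sup>2 (2 + \<sigma>) / (\<sigma> (1 + \<sigma>))\<close>, which is not zero.
\<close>

(* The dollar sign denotes vector components here, not coefficients of formal power series. *)
no_notation fps_nth (infixl \<open>$\<close> 75)

section \<open>Absolutely convergent power series in several variables\<close>

abbreviation multi_indices :: "('a::euclidean_space \<Rightarrow> nat) set" where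
  "multi_indices \<equiv> Basis \<rightarrow>\<^sub>E UNIV"

definition monomial :: "('a::euclidean_space \<Rightarrow> nat) \<Rightarrow> 'a \<Rightarrow> real" where
  "monomial k v = (\<Prod>b\<in>Basis. (v \<bullet> b) ^ k b)"

definition degree_of :: "('a::euclidean_space \<Rightarrow> nat) \<Rightarrow> nat" where
  "degree_of k = (\<Sum>b\<in>Basis. k b)"

definition cube :: "real \<Rightarrow> 'a::euclidean_space \<Rightarrow> 'a set" where
  "cube r p = {q. \<forall>b\<in>Basis. \<bar>(q - p) \<bullet> b\<bar> \<le> r}"

text \<open>
  The number \<open>M\<close> bounds the sum of the absolute values of all terms at the corner of the cube. With
  it, convergence of infinite sums and compositions of such functions can be controlled by series of
  real numbers.
\<close>

definition expands ::
    "real \<Rightarrow> 'a::euclidean_space \<Rightarrow> ('a \<Rightarrow> complex) \<Rightarrow> real \<Rightarrow> bool" where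
  "expands r p f M \<longleftrightarrow> (\<exists>a N. N \<le> M \<and>
     ((\<lambda>k. norm (a k) * r ^ degree_of k) has_sum N) multi_indices \<and>
     (\<forall>q\<in>cube r p. ((\<lambda>k. monomial k (q - p) *\<^sub>R a k) has_sum f q) multi_indices))"

definition expandable_at :: "'a::euclidean_space \<Rightarrow> ('a \<Rightarrow> complex) \<Rightarrow> bool" where
  "expandable_at p f \<longleftrightarrow> (\<exists>r>0. \<exists>M. expands r p f M)"

lemma monomial_le:
  assumes "q \<in> cube r p"
  shows "\<bar>monomial k (q - p)\<bar> \<le> r ^ degree_of k"
proof -
  have "\<bar>monomial k (q - p)\<bar> = (\<Prod>b\<in>Basis. \<bar>(q - p) \<bullet> b\<bar> ^ k b)"
    by (simp add: monomial_def abs_prod power_abs)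
  also have "\<dots> \<le> (\<Prod>b\<in>Basis. r ^ k b)"
    using assms by (intro prod_mono) (auto simp: cube_def intro!: power_mono)
  also have "\<dots> = r ^ degree_of k"
    by (simp add: degree_of_def power_sum)
  finally show ?thesis .
qed

lemma ball_subset_cube: "ball p r \<subseteq> cube r p"
proof
  fix q assume "q \<in> ball p r"
  then have "norm (q - p) < r" by (simp add: dist_norm norm_minus_commute)
  then show "q \<in> cube r p"
    unfolding cube_def using Basis_le_norm[of _ "q - p"] by force
qed

lemma expandable_imp_real_analytic:
  assumes "\<And>p. p \<in> S \<Longrightarrow> expandable_at p f"
  shows "f real_analytic_on S"
  unfolding real_analytic_on_def
proof
  fix p assume "p \<in> S"
  then obtain r M where "r > 0" "expands r p f M"
    using assms unfolding expandable_at_def by blast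
  then obtain a where "\<forall>q\<in>cube r p. ((\<lambda>k. monomial k (q - p) *\<^sub>R a k) has_sum f q) multi_indices"
    unfolding expands_def by blast
  then show "\<exists>r>0. \<exists>a. \<forall>q\<in>ball p r.
       ((\<lambda>k. (\<Prod>b\<in>Basis. ((q - p) \<bullet> b) ^ k b) *\<^sub>R a k) has_sum f q) multi_indices"
    using \<open>r > 0\<close> ball_subset_cube[of p r] unfolding monomial_def by blast
qed

text \<open>
  A series of monomial terms over any index set, in which monomials may repeat, can be collected into
  a power series without increasing the majorant. Products and infinite sums of power series are
  naturally indexed by pairs, and this lemma is what turns them back into power series.
\<close>

lemma expands_regroup:
  fixes f :: "'a::euclidean_space \<Rightarrow> complex" and c :: "'j \<Rightarrow> complex"
  assumes "r > 0" and m: "\<And>j. j \<in> J \<Longrightarrow> m j \<in> multi_indices"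
    and maj: "((\<lambda>j. norm (c j) * r ^ degree_of (m j)) has_sum N) J" and "N \<le> M"
    and f: "\<And>q. q \<in> cube r p \<Longrightarrow> ((\<lambda>j. monomial (m j) (q - p) *\<^sub>R c j) has_sum f q) J"
  shows "expands r p f M"
proof -
  define F where "F k = {j \<in> J. m j = k}" for k
  define a where "a k = (\<Sum>\<^sub>\<infinity>j\<in>F k. c j)" for k
  define n where "n k = (\<Sum>\<^sub>\<infinity>j\<in>F k. norm (c j) * r ^ degree_of (m j))" for k
  have bij: "bij_betw snd (Sigma multi_indices F) J"
    using m by (auto simp: bij_betw_def inj_on_def F_def image_iff)
  have maj': "((\<lambda>x. norm (c (snd x)) * r ^ degree_of (m (snd x))) has_sum N) (Sigma multi_indices F)"
    using has_sum_reindex_bij_betw[OF bij, of "\<lambda>j. norm (c j) * r ^ degree_of (m j)" N] maj by simp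
  have "(\<lambda>j. norm (c j) * r ^ degree_of (m j)) summable_on F k" for k
    using maj by (rule summable_on_subset_banach[OF has_sum_imp_summable]) (auto simp: F_def)
  then have n: "((\<lambda>j. norm (c j) * r ^ degree_of (m j)) has_sum n k) (F k)" for k
    unfolding n_def by (rule has_sum_infsum)
  have nN: "(n has_sum N) multi_indices"
    by (rule has_sum_SigmaD[OF maj']) (use n in simp)
  have n': "((\<lambda>j. norm (c j) * r ^ degree_of k) has_sum n k) (F k)" for k
    using n[of k] by (rule has_sum_cong[THEN iffD1, rotated]) (auto simp: F_def)
  have nc: "((\<lambda>j. norm (c j)) has_sum (n k / r ^ degree_of k)) (F k)" for k
    using has_sum_cmult_left[OF n'[of k], of "1 / r ^ degree_of k"] \<open>r > 0\<close> by simp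
  have sc: "c summable_on F k" for k
    by (rule Infinite_Sum.abs_summable_summable[OF has_sum_imp_summable[OF nc]])
  have a: "(c has_sum a k) (F k)" for k
    unfolding a_def using sc by (rule has_sum_infsum)
  have an: "norm (a k) * r ^ degree_of k \<le> n k" for k
  proof -
    have "norm (a k) \<le> n k / r ^ degree_of k"
      using norm_has_sum_bound[OF _ a] nc[of k] norm_infsum_bound[of c "F k"]
      by (metis a_def has_sum_imp_summable infsumI)
    then show ?thesis using \<open>r > 0\<close> by (simp add: pos_le_divide_eq)
  qed
  have "(\<lambda>k. norm (a k) * r ^ degree_of k) summable_on multi_indices"
    by (rule summable_on_comparison_test[OF has_sum_imp_summable[OF nN]]) (use an \<open>r > 0\<close> in auto)
  then obtain N' where N': "((\<lambda>k. norm (a k) * r ^ degree_of k) has_sum N') multi_indices"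
    using has_sum_infsum by blast
  have "N' \<le> N" using N' nN an by (rule has_sum_mono)
  have "((\<lambda>k. monomial k (q - p) *\<^sub>R a k) has_sum f q) multi_indices" if "q \<in> cube r p" for q
  proof (rule has_sum_SigmaD)
    show "((\<lambda>x. monomial (m (snd x)) (q - p) *\<^sub>R c (snd x)) has_sum f q) (Sigma multi_indices F)"
      using has_sum_reindex_bij_betw[OF bij, of "\<lambda>j. monomial (m j) (q - p) *\<^sub>R c j"] f[OF that] by simp
    show "((\<lambda>y. monomial (m (snd (k, y))) (q - p) *\<^sub>R c (snd (k, y)))
        has_sum monomial k (q - p) *\<^sub>R a k) (F k)" for k
      using has_sum_scaleR[OF a[of k]]
      by (rule has_sum_cong[THEN iffD1, rotated]) (auto simp: F_def)
  qed
  then show ?thesis unfolding expands_def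
    using N' \<open>N' \<le> N\<close> \<open>N \<le> M\<close> by (intro exI[of _ a] exI[of _ N']) auto
qed

lemma expands_shrink:
  assumes "expands r p f M" "0 < s" "s \<le> r"
  shows "expands s p f M"
proof -
  obtain a N where aN: "N \<le> M" "((\<lambda>k. norm (a k) * r ^ degree_of k) has_sum N) multi_indices"
    and f: "\<And>q. q \<in> cube r p \<Longrightarrow> ((\<lambda>k. monomial k (q - p) *\<^sub>R a k) has_sum f q) multi_indices"
    using assms unfolding expands_def by blast
  have le: "norm (a k) * s ^ degree_of k \<le> norm (a k) * r ^ degree_of k" for k
    using assms by (intro mult_left_mono power_mono) auto
  have "(\<lambda>k. norm (a k) * s ^ degree_of k) summable_on multi_indices"
    by (rule summable_on_comparison_test[OF has_sum_imp_summable[OF aN(2)]])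
       (use le \<open>0 < s\<close> in auto)
  then obtain N' where N': "((\<lambda>k. norm (a k) * s ^ degree_of k) has_sum N') multi_indices"
    using has_sum_infsum by blast
  have "N' \<le> N" using N' aN(2) le by (rule has_sum_mono)
  moreover have "cube s p \<subseteq> cube r p" using \<open>s \<le> r\<close> by (auto simp: cube_def)
  ultimately show ?thesis unfolding expands_def using aN(1) N' f by (meson order_trans subsetD)
qed

lemma expands_norm_le:
  assumes "expands r p f M" "q \<in> cube r p"
  shows "norm (f q) \<le> M"
proof -
  obtain a N where aN: "N \<le> M" "((\<lambda>k. norm (a k) * r ^ degree_of k) has_sum N) multi_indices"
    and f: "((\<lambda>k. monomial k (q - p) *\<^sub>R a k) has_sum f q) multi_indices"
    using assms unfolding expands_def by blast
  have "norm (monomial k (q - p) *\<^sub>R a k) \<le> norm (a k) * r ^ degree_of k" for k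
    using mult_right_mono[OF monomial_le[OF assms(2), of k], of "norm (a k)"] by (simp add: mult.commute)
  then have "norm (infsum (\<lambda>k. monomial k (q - p) *\<^sub>R a k) multi_indices) \<le> N"
    using norm_infsum_le[OF f[THEN has_sum_infsum[OF has_sum_imp_summable]] aN(2)] by blast
  then show ?thesis using aN(1) infsumI[OF f] by simp
qed

lemma expands_has_sum:
  fixes f :: "'j \<Rightarrow> 'a::euclidean_space \<Rightarrow> complex"
  assumes "r > 0" and fM: "\<And>j. j \<in> J \<Longrightarrow> expands r p (f j) (M j)"
    and M: "(M has_sum M') J"
    and sum: "\<And>q. q \<in> cube r p \<Longrightarrow> ((\<lambda>j. f j q) has_sum g q) J"
  shows "expands r p g M'"
proof -
  have "\<forall>j\<in>J. \<exists>a N. N \<le> M j \<and>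
     ((\<lambda>k. norm (a k) * r ^ degree_of k) has_sum N) multi_indices \<and>
     (\<forall>q\<in>cube r p. ((\<lambda>k. monomial k (q - p) *\<^sub>R a k) has_sum f j q) multi_indices)"
    using fM unfolding expands_def by blast
  from bchoice[OF this] obtain a where "\<forall>j\<in>J. \<exists>N. N \<le> M j \<and>
     ((\<lambda>k. norm (a j k) * r ^ degree_of k) has_sum N) multi_indices \<and>
     (\<forall>q\<in>cube r p. ((\<lambda>k. monomial k (q - p) *\<^sub>R a j k) has_sum f j q) multi_indices)" ..
  from bchoice[OF this] obtain N where aN: "\<forall>j\<in>J. N j \<le> M j \<and>
     ((\<lambda>k. norm (a j k) * r ^ degree_of k) has_sum N j) multi_indices \<and>
     (\<forall>q\<in>cube r p. ((\<lambda>k. monomial k (q - p) *\<^sub>R a j k) has_sum f j q) multi_indices)" ..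
  have N: "\<And>j. j \<in> J \<Longrightarrow> N j \<le> M j"
      "\<And>j. j \<in> J \<Longrightarrow> ((\<lambda>k. norm (a j k) * r ^ degree_of k) has_sum N j) multi_indices"
    and a: "\<And>j q. j \<in> J \<Longrightarrow> q \<in> cube r p \<Longrightarrow>
        ((\<lambda>k. monomial k (q - p) *\<^sub>R a j k) has_sum f j q) multi_indices"
    using aN by blast+
  have N0: "0 \<le> N j" if "j \<in> J" for j
    using N(2)[OF that] by (rule has_sum_nonneg) (use \<open>r > 0\<close> in auto)
  have "N summable_on J"
    by (rule summable_on_comparison_test[OF has_sum_imp_summable[OF M]]) (use N N0 in auto)
  then obtain N' where N': "(N has_sum N') J" using has_sum_infsum by blast
  have "N' \<le> M'" using N' M N(1) by (rule has_sum_mono)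
  let ?c = "\<lambda>(j, k). norm (a j k) * r ^ degree_of k"
  have summ: "?c summable_on J \<times> multi_indices"
    by (rule summable_on_SigmaI[OF _ has_sum_imp_summable[OF N']]) (use N(2) \<open>r > 0\<close> in auto)
  have maj: "(?c has_sum N') (J \<times> multi_indices)"
    by (rule has_sum_SigmaI[OF _ N' summ]) (use N(2) in auto)
  show ?thesis
  proof (rule expands_regroup[OF \<open>r > 0\<close>, where J = "J \<times> multi_indices" and m = snd and c = "\<lambda>(j, k). a j k"])
    show "((\<lambda>x. norm (case x of (j, k) \<Rightarrow> a j k) * r ^ degree_of (snd x)) has_sum N') (J \<times> multi_indices)"
      using maj by (simp add: case_prod_unfold)
    fix q assume q: "q \<in> cube r p"
    have "(\<lambda>x. norm (case x of (j, k) \<Rightarrow> monomial k (q - p) *\<^sub>R a j k)) summable_on J \<times> multi_indices"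
    proof (rule summable_on_comparison_test[OF summ])
      show "norm (case x of (j, k) \<Rightarrow> monomial k (q - p) *\<^sub>R a j k) \<le> ?c x" for x
        using mult_right_mono[OF monomial_le[OF q, of "snd x"], of "norm (a (fst x) (snd x))"]
        by (simp add: mult.commute case_prod_unfold)
    qed auto
    then have "(\<lambda>(j, k). monomial k (q - p) *\<^sub>R a j k) summable_on J \<times> multi_indices"
      by (rule Infinite_Sum.abs_summable_summable)
    then have "((\<lambda>(j, k). monomial k (q - p) *\<^sub>R a j k) has_sum g q) (J \<times> multi_indices)"
      by (rule has_sum_SigmaI[OF _ sum[OF q], rotated]) (use a[OF _ q] in auto)
    then show "((\<lambda>x. monomial (snd x) (q - p) *\<^sub>R (case x of (j, k) \<Rightarrow> a j k)) has_sum g q) (J \<times> multi_indices)"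
      by (simp add: case_prod_unfold)
  qed (use \<open>N' \<le> M'\<close> in auto)
qed

text \<open>
  The norm is submultiplicative because the exponents of a product add up; the Cauchy product is the
  double series over pairs of multi-indices, regrouped by the sum of the two.
\<close>

lemma expands_mult:
  assumes "r > 0" "expands r p f M" "expands r p g L"
  shows "expands r p (\<lambda>q. f q * g q) (M * L)"
proof -
  obtain a N where N: "N \<le> M" "((\<lambda>k. norm (a k) * r ^ degree_of k) has_sum N) multi_indices"
    and a: "\<And>q. q \<in> cube r p \<Longrightarrow> ((\<lambda>k. monomial k (q - p) *\<^sub>R a k) has_sum f q) multi_indices"
    using assms unfolding expands_def by blast
  obtain b N' where N': "N' \<le> L" "((\<lambda>k. norm (b k) * r ^ degree_of k) has_sum N') multi_indices"
    and b: "\<And>q. q \<in> cube r p \<Longrightarrow> ((\<lambda>k. monomial k (q - p) *\<^sub>R b k) has_sum g q) multi_indices"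
    using assms unfolding expands_def by blast
  define add where "add = (\<lambda>(i, j). \<lambda>x\<in>(Basis :: 'a set). i x + j x :: nat)"
  have monomial_add: "monomial (add (i, j)) v = monomial i v * monomial j v" for i j v
    by (simp add: monomial_def add_def power_add prod.distrib)
  have degree_add: "degree_of (add (i, j)) = degree_of i + degree_of j" for i j
    by (simp add: degree_of_def add_def sum.distrib)
  let ?I = "multi_indices :: ('a \<Rightarrow> nat) set"
  let ?c = "\<lambda>(i, j). norm (a i) * r ^ degree_of i * (norm (b j) * r ^ degree_of j)"
  have "N \<ge> 0" using N(2) by (rule has_sum_nonneg) (use \<open>r > 0\<close> in auto)
  have "N' \<ge> 0" using N'(2) by (rule has_sum_nonneg) (use \<open>r > 0\<close> in auto)
  have "M * L \<ge> N * N'" using N(1) N'(1) \<open>N \<ge> 0\<close> \<open>N' \<ge> 0\<close> by (intro mult_mono) auto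
  have summ: "?c summable_on ?I \<times> ?I"
    by (rule summable_on_SigmaI[OF _ has_sum_imp_summable[OF has_sum_cmult_left[OF N(2)]]])
       (use has_sum_cmult_right[OF N'(2)] \<open>r > 0\<close> in auto)
  have maj: "(?c has_sum N * N') (?I \<times> ?I)"
    by (rule has_sum_SigmaI[OF _ has_sum_cmult_left[OF N(2)] summ])
       (use has_sum_cmult_right[OF N'(2)] in auto)
  show ?thesis
  proof (rule expands_regroup[OF \<open>r > 0\<close>, where J = "?I \<times> ?I" and m = add and c = "\<lambda>(i, j). a i * b j"])
    show "add x \<in> multi_indices" for x
      by (auto simp: add_def case_prod_unfold)
    have "?c x = norm (case x of (i, j) \<Rightarrow> a i * b j) * r ^ degree_of (add x)" for x
      by (cases x) (simp add: degree_add power_add norm_mult)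
    then show "((\<lambda>x. norm (case x of (i, j) \<Rightarrow> a i * b j) * r ^ degree_of (add x)) has_sum N * N') (?I \<times> ?I)"
      using maj by presburger
    fix q assume q: "q \<in> cube r p"
    let ?t = "\<lambda>x. monomial (add x) (q - p) *\<^sub>R (case x of (i, j) \<Rightarrow> a i * b j)"
    have t: "?t (i, j) = (monomial i (q - p) *\<^sub>R a i) * (monomial j (q - p) *\<^sub>R b j)" for i j
      by (simp add: monomial_add)
    have "(\<lambda>x. norm (?t x)) summable_on ?I \<times> ?I"
    proof (rule summable_on_comparison_test[OF summ])
      fix x :: "('a \<Rightarrow> nat) \<times> ('a \<Rightarrow> nat)"
      obtain i j where x: "x = (i, j)" by (cases x)
      have "norm (monomial i (q - p) *\<^sub>R a i) * norm (monomial j (q - p) *\<^sub>R b j) \<le>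
          (norm (a i) * r ^ degree_of i) * (norm (b j) * r ^ degree_of j)"
        using mult_right_mono[OF monomial_le[OF q, of i], of "norm (a i)"]
          mult_right_mono[OF monomial_le[OF q, of j], of "norm (b j)"] \<open>r > 0\<close>
        by (intro mult_mono) (auto simp: mult.commute)
      then show "norm (?t x) \<le> ?c x" unfolding x t norm_mult by simp
    qed auto
    then have "?t summable_on ?I \<times> ?I" by (rule Infinite_Sum.abs_summable_summable)
    then show "(?t has_sum f q * g q) (?I \<times> ?I)"
      by (rule has_sum_SigmaI[OF _ has_sum_cmult_left[OF a[OF q]], rotated])
         (unfold t, rule has_sum_cmult_right[OF b[OF q]])
  qed (use \<open>M * L \<ge> N * N'\<close> in auto)
qed

lemma expands_const:
  assumes "r > 0" shows "expands r p (\<lambda>_. z) (norm z)"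
proof (rule expands_regroup[OF assms, where J = "{()}" and m = "\<lambda>_. \<lambda>_\<in>Basis. 0" and c = "\<lambda>_. z"])
qed (auto simp: degree_of_def monomial_def intro: has_sum_finiteI)

lemma expands_power:
  assumes "r > 0" "expands r p f M"
  shows "expands r p (\<lambda>q. f q ^ n) (M ^ n)"
proof (induction n)
  case 0
  then show ?case using expands_const[OF \<open>r > 0\<close>, of p 1] by simp
next
  case (Suc n)
  then show ?case using expands_mult[OF assms] by simp
qed

lemma common_radius:
  assumes "expandable_at p f" "expandable_at p g"
  obtains r M L where "r > 0" "expands r p f M" "expands r p g L"
proof -
  obtain r M s L where "r > 0" "expands r p f M" "s > 0" "expands s p g L"
    using assms unfolding expandable_at_def by blast
  moreover have "expands (min r s) p f M" "expands (min r s) p g L"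
    using calculation by (auto intro: expands_shrink)
  ultimately show thesis by (intro that[of "min r s"]) auto
qed

lemma expandable_const: "expandable_at p (\<lambda>_. z)"
  unfolding expandable_at_def using expands_const[OF zero_less_one, of p z] zero_less_one by blast

lemma expandable_mult:
  assumes "expandable_at p f" "expandable_at p g"
  shows "expandable_at p (\<lambda>q. f q * g q)"
proof -
  obtain r M L where "r > 0" "expands r p f M" "expands r p g L"
    using common_radius[OF assms] .
  then have "expands r p (\<lambda>q. f q * g q) (M * L)" by (rule expands_mult)
  then show ?thesis using \<open>r > 0\<close> unfolding expandable_at_def by blast
qed

lemma expandable_add:
  assumes "expandable_at p f" "expandable_at p g"
  shows "expandable_at p (\<lambda>q. f q + g q)"
proof -
  obtain r M L where r: "r > 0" "expands r p f M" "expands r p g L"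
    using common_radius[OF assms] .
  have "expands r p (\<lambda>q. f q + g q) (M + L)"
    by (rule expands_has_sum[OF \<open>r > 0\<close>, where J = UNIV and f = "\<lambda>j. if j then f else g"
          and M = "\<lambda>j. if j then M else L"])
       (use r in \<open>auto simp: UNIV_bool add.commute intro!: has_sum_finiteI\<close>)
  then show ?thesis using \<open>r > 0\<close> unfolding expandable_at_def by blast
qed

text \<open>
  The expansion \<open>q \<bullet> b = p \<bullet> b + (q - p) \<bullet> b\<close> has two terms, which are indexed by \<open>bool\<close>:
  \<open>False\<close> is the constant term and \<open>True\<close> the linear one.
\<close>

lemma expandable_coordinate:
  assumes "b \<in> Basis"
  shows "expandable_at p (\<lambda>q. complex_of_real (q \<bullet> b))"
proof -
  let ?m = "\<lambda>j. \<lambda>x\<in>Basis. if j \<and> x = b then 1 else 0 :: nat"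
  let ?c = "\<lambda>j. if j then 1 else complex_of_real (p \<bullet> b)"
  have deg: "degree_of (?m j) = of_bool j" for j
    using assms by (auto simp: degree_of_def)
  have mon: "monomial (?m j) v = (if j then v \<bullet> b else 1)" for j v
  proof -
    have "monomial (?m j) v = (\<Prod>x\<in>Basis. if x = b then (if j then v \<bullet> b else 1) else 1)"
      unfolding monomial_def by (rule prod.cong) auto
    then show ?thesis using assms by simp
  qed
  have "expands 1 p (\<lambda>q. complex_of_real (q \<bullet> b)) (1 + \<bar>p \<bullet> b\<bar>)"
  proof (rule expands_regroup[where J = UNIV and m = ?m and c = ?c])
    show "((\<lambda>j. monomial (?m j) (q - p) *\<^sub>R ?c j) has_sum complex_of_real (q \<bullet> b)) UNIV" for q
      unfolding mon by (rule has_sum_finiteI) (auto simp: UNIV_bool inner_diff_left scaleR_conv_of_real)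
    show "((\<lambda>j. norm (?c j) * 1 ^ degree_of (?m j)) has_sum (1 + \<bar>p \<bullet> b\<bar>)) UNIV"
      by (rule has_sum_finiteI) (auto simp: UNIV_bool)
  qed auto
  then show ?thesis unfolding expandable_at_def by (intro exI[of _ 1]) auto
qed

text \<open>
  Without its constant term every monomial has degree at least one, so shrinking the cube by a factor
  shrinks the majorant at least by the same factor. This is what makes substitution into a power
  series with finite radius of convergence possible.
\<close>

lemma expandable_small_increment:
  assumes "expandable_at p f" "e > 0"
  obtains r where "r > 0" "expands r p (\<lambda>q. f q - f p) e"
proof -
  obtain r0 M where "r0 > 0" "expands r0 p f M"
    using assms unfolding expandable_at_def by blast
  then obtain a N where N: "((\<lambda>k. norm (a k) * r0 ^ degree_of k) has_sum N) multi_indices"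
    and a: "\<And>q. q \<in> cube r0 p \<Longrightarrow> ((\<lambda>k. monomial k (q - p) *\<^sub>R a k) has_sum f q) multi_indices"
    unfolding expands_def by blast
  have "N \<ge> 0" using N by (rule has_sum_nonneg) (use \<open>r0 > 0\<close> in auto)
  let ?o = "(\<lambda>_\<in>Basis. 0) :: 'a \<Rightarrow> nat"
  let ?I = "multi_indices :: ('a \<Rightarrow> nat) set"
  have o: "?o \<in> ?I" by auto
  have pos: "degree_of k > 0" if k: "k \<in> ?I - {?o}" for k
  proof (rule ccontr)
    assume "\<not> degree_of k > 0"
    then have "\<forall>b\<in>Basis. k b = 0" by (simp add: degree_of_def)
    then have "k = ?o" using k by (intro PiE_ext[of k _ _ ?o]) auto
    then show False using k by simp
  qed
  have mon0: "monomial k (p - p) = 0" if k: "k \<in> ?I - {?o}" for k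
  proof -
    obtain b where "b \<in> Basis" "k b > 0"
      using pos[OF k] unfolding degree_of_def by (metis gr0I less_irrefl sum.neutral)
    then show ?thesis unfolding monomial_def by (intro prod_zero) (auto intro!: bexI[of _ b])
  qed
  have fp: "f p = a ?o"
  proof -
    have "((\<lambda>k. monomial k (p - p) *\<^sub>R a k) has_sum f p) ?I"
      using a[of p] \<open>r0 > 0\<close> by (simp add: cube_def)
    moreover have "((\<lambda>k. monomial k (p - p) *\<^sub>R a k) has_sum a ?o) ?I"
      by (rule has_sum_finite_neutralI[of "{?o}"]) (use mon0 o in \<open>auto simp: monomial_def\<close>)
    ultimately show ?thesis by (rule has_sum_unique)
  qed
  \<comment> \<open>The \<open>1\<close> added to \<open>N\<close> only avoids a division by zero.\<close>
  define r where "r = r0 * min 1 (e / (N + 1))"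
  have r: "0 < r" "r \<le> r0" and re: "r / r0 * N \<le> e"
  proof -
    show "0 < r" "r \<le> r0" using \<open>r0 > 0\<close> \<open>N \<ge> 0\<close> \<open>e > 0\<close> by (auto simp: r_def mult_left_le)
    have "r / r0 * N \<le> e / (N + 1) * N"
      using \<open>r0 > 0\<close> \<open>N \<ge> 0\<close> by (intro mult_right_mono) (auto simp: r_def)
    also have "\<dots> \<le> e" using \<open>N \<ge> 0\<close> \<open>e > 0\<close> by (simp add: field_simps)
    finally show "r / r0 * N \<le> e" .
  qed
  have le: "norm (a k) * r ^ degree_of k \<le> (r / r0) * (norm (a k) * r0 ^ degree_of k)"
    if "k \<in> ?I - {?o}" for k
  proof -
    have "(r / r0) ^ degree_of k \<le> (r / r0) ^ 1"
      using r pos[OF that] by (intro power_decreasing) auto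
    then have "r ^ degree_of k \<le> (r / r0) * r0 ^ degree_of k"
      using \<open>r0 > 0\<close> by (simp add: power_divide field_simps)
    from mult_left_mono[OF this norm_ge_zero[of "a k"]] show ?thesis
      by (simp add: algebra_simps)
  qed
  have "(\<lambda>k. norm (a k) * r0 ^ degree_of k) summable_on ?I - {?o}"
    using N by (rule summable_on_subset_banach[OF has_sum_imp_summable]) auto
  then obtain N1 where N1: "((\<lambda>k. norm (a k) * r0 ^ degree_of k) has_sum N1) (?I - {?o})"
    using has_sum_infsum by blast
  have "N1 \<le> N"
    by (rule has_sum_mono2[OF N1 N]) (use \<open>r0 > 0\<close> in auto)
  note N1' = has_sum_cmult_right[OF N1, of "r / r0"]
  have "(\<lambda>k. norm (a k) * r ^ degree_of k) summable_on ?I - {?o}"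
    by (rule summable_on_comparison_test[OF has_sum_imp_summable[OF N1']]) (use le r in auto)
  then obtain N2 where N2: "((\<lambda>k. norm (a k) * r ^ degree_of k) has_sum N2) (?I - {?o})"
    using has_sum_infsum by blast
  have "N2 \<le> r / r0 * N1" using N2 N1' le by (rule has_sum_mono)
  also have "\<dots> \<le> r / r0 * N" using \<open>N1 \<le> N\<close> r \<open>r0 > 0\<close> by (intro mult_left_mono) auto
  also note re
  finally have "N2 \<le> e" .
  have "expands r p (\<lambda>q. f q - f p) e"
  proof (rule expands_regroup[OF \<open>0 < r\<close>, where J = "?I - {?o}" and m = "\<lambda>k. k" and c = a])
    fix q assume "q \<in> cube r p"
    then have "q \<in> cube r0 p" using r by (auto simp: cube_def)
    from has_sum_Diff[OF a[OF this] has_sum_finite[of "{?o}"]] o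
    show "((\<lambda>k. monomial k (q - p) *\<^sub>R a k) has_sum f q - f p) (?I - {?o})"
      by (simp add: fp monomial_def)
  qed (use N2 \<open>N2 \<le> e\<close> in auto)
  then show thesis using that \<open>0 < r\<close> by blast
qed

text \<open>
  Let \<open>G\<close> have the power series with coefficients \<open>g n\<close> around \<open>f p\<close>. On a small cube the increment
  \<open>f q - f p\<close> has norm at most a number \<open>e\<close> inside the disc of convergence, so its \<open>n\<close>-th power has
  norm at most \<open>e ^ n\<close>, and the outer series converges in norm.
\<close>

lemma expandable_holomorphic_compose:
  assumes f: "expandable_at p f" and "open S" "f p \<in> S" "G holomorphic_on S"
  shows "expandable_at p (\<lambda>q. G (f q))"
proof -
  obtain R where R: "R > 0" "ball (f p) R \<subseteq> S" using \<open>open S\<close> \<open>f p \<in> S\<close> openE by blast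
  define g where "g n = (deriv ^^ n) G (f p) / fact n" for n
  have G: "(\<lambda>n. g n * (w - f p) ^ n) sums G w" if "w \<in> ball (f p) R" for w
    unfolding g_def using holomorphic_power_series[OF _ that] \<open>G holomorphic_on S\<close> R(2)
    by (meson holomorphic_on_subset)
  define e where "e = R / 3"
  obtain r where "r > 0" and h: "expands r p (\<lambda>q. f q - f p) e"
    using expandable_small_increment[OF f, of e] R(1) by (auto simp: e_def)
  have "summable (\<lambda>n. g n * complex_of_real (R / 2) ^ n)"
    using G[of "f p + of_real (R / 2)"] R(1) by (auto simp: sums_iff dist_norm)
  then have "summable (\<lambda>n. norm (g n * complex_of_real e ^ n))"
    by (rule powser_insidea) (use R(1) in \<open>simp add: e_def\<close>)
  then have ge: "summable (\<lambda>n. norm (g n) * e ^ n)"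
    using R(1) by (simp add: norm_mult norm_power e_def)
  have "expands r p (\<lambda>q. G (f q)) (\<Sum>n. norm (g n) * e ^ n)"
  proof (rule expands_has_sum[OF \<open>r > 0\<close>, where J = UNIV and f = "\<lambda>n q. g n * (f q - f p) ^ n"])
    show "expands r p (\<lambda>q. g n * (f q - f p) ^ n) (norm (g n) * e ^ n)" for n
      by (rule expands_mult[OF \<open>r > 0\<close> expands_const[OF \<open>r > 0\<close>] expands_power[OF \<open>r > 0\<close> h]])
    show "((\<lambda>n. norm (g n) * e ^ n) has_sum (\<Sum>n. norm (g n) * e ^ n)) UNIV"
      using ge R(1) by (intro norm_summable_imp_has_sum) (auto simp: e_def intro: summable_sums)
    fix q assume "q \<in> cube r p"
    then have he: "norm (f q - f p) \<le> e" by (rule expands_norm_le[OF h])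
    show "((\<lambda>n. g n * (f q - f p) ^ n) has_sum G (f q)) UNIV"
    proof (rule norm_summable_imp_has_sum)
      show "summable (\<lambda>n. norm (g n * (f q - f p) ^ n))"
        by (rule summable_comparison_test'[OF ge, of 0])
           (use he in \<open>auto simp: norm_mult norm_power intro!: mult_left_mono power_mono\<close>)
      show "(\<lambda>n. g n * (f q - f p) ^ n) sums G (f q)"
        using he R(1) by (intro G) (auto simp: dist_norm norm_minus_commute e_def)
    qed
  qed
  then show ?thesis using \<open>r > 0\<close> unfolding expandable_at_def by blast
qed

section \<open>Square roots and partial derivatives\<close>

text \<open>
  The quotient of the two roots is continuous with values \<open>1\<close> and \<open>-1\<close>, hence constant.
\<close>

lemma continuous_square_roots_agree:
  fixes f g :: "'a::topological_space \<Rightarrow> complex"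
  assumes "connected D" "continuous_on D f" "continuous_on D g"
    and sq: "\<And>p. p \<in> D \<Longrightarrow> (f p)\<^sup>2 = (g p)\<^sup>2" and g0: "\<And>p. p \<in> D \<Longrightarrow> g p \<noteq> 0"
    and "p0 \<in> D" "f p0 = g p0" "p \<in> D"
  shows "f p = g p"
proof -
  have quot: "f p / g p \<in> {1, -1}" if "p \<in> D" for p
    using sq[OF that] g0[OF that] unfolding power2_eq_iff by auto
  have "(\<lambda>p. f p / g p) constant_on D"
  proof (rule continuous_finite_range_constant[OF \<open>connected D\<close>])
    show "continuous_on D (\<lambda>p. f p / g p)"
      by (intro continuous_intros assms(2,3)) (use g0 in auto)
    show "finite ((\<lambda>p. f p / g p) ` D)"
      by (rule finite_subset[of _ "{1, -1}"]) (use quot in blast, simp)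
  qed
  then have "f p / g p = f p0 / g p0"
    using \<open>p0 \<in> D\<close> \<open>p \<in> D\<close> unfolding constant_on_def by metis
  then show ?thesis using assms g0 by simp
qed

lemma has_derivative_csqrt:
  assumes "(f has_derivative f') (at p)" "f p \<notin> \<real>\<^sub>\<le>\<^sub>0"
  shows "((\<lambda>x. csqrt (f x)) has_derivative (\<lambda>v. f' v / (2 * csqrt (f p)))) (at p)"
  using has_derivative_compose[OF assms(1) has_field_derivative_imp_has_derivative[OF has_field_derivative_csqrt[OF assms(2)]]]
  by (simp add: field_simps)

lemma partial_deriv_eq:
  assumes "(f has_derivative D) (at p)"
  shows "partial_deriv i f p = D (axis i 1)"
proof -
  have "((\<lambda>t. f (p + t *\<^sub>R axis i 1)) has_derivative (\<lambda>t. D (t *\<^sub>R axis i 1))) (at 0)"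
    by (rule has_derivative_compose[where f = "\<lambda>t. p + t *\<^sub>R axis i 1" and g = f])
       (use assms in \<open>auto intro!: derivative_eq_intros\<close>)
  then have "((\<lambda>t. f (p + t *\<^sub>R axis i 1)) has_vector_derivative D (axis i 1)) (at 0)"
    using bounded_linear.linear[OF has_derivative_bounded_linear[OF assms]]
    by (simp add: has_vector_derivative_def linear_scale)
  then show ?thesis unfolding partial_deriv_def by (rule vector_derivative_at)
qed

section \<open>The branch of the square root and the removed singularity\<close>

text \<open>
  The global square root of the radicand; only the second factor of \<open>sigma\<close> needs a branch of the root,
  and its argument stays off the negative axis.
\<close>

definition omega :: "complex \<Rightarrow> real \<Rightarrow> complex" where
  "omega c z = 1 + c * of_real z"

definition sigma :: "complex \<Rightarrow> real \<Rightarrow> real \<Rightarrow> complex" where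
  "sigma c u z = omega c z * csqrt (1 - 6 * c\<^sup>2 * of_real u / (omega c z)\<^sup>2)"

text \<open>
  This is \<open>\<psi>\<close> after the singularity at \<open>u = 0\<close> has been cancelled.
\<close>

definition profile :: "complex \<Rightarrow> real \<times> real \<Rightarrow> complex" where
  "profile c = (\<lambda>(u, z). 2 / 9 * (2 * omega c z + sigma c u z)\<^sup>2 / (omega c z + sigma c u z))"

locale admissible =
  fixes c :: complex
  assumes c0: "c \<noteq> 0"
    and w0: "\<And>z :: real. 1 + c * of_real z \<noteq> 0"
    and R0: "\<And>u z :: real. u \<ge> 0 \<Longrightarrow> (1 + c * of_real z)\<^sup>2 - 6 * c\<^sup>2 * of_real u \<noteq> 0"
begin

lemma omega_neq_0: "omega c z \<noteq> 0"
  using w0 by (simp add: omega_def)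

text \<open>
  A value \<open>x \<le> 0\<close> of the expression would produce a zero of the radicand at the parameter
  \<open>u / (1 - x)\<close> on the same ray.
\<close>

lemma root_argument_not_nonpos:
  assumes "u \<ge> 0"
  shows "1 - 6 * c\<^sup>2 * of_real u / (omega c z)\<^sup>2 \<notin> \<real>\<^sub>\<le>\<^sub>0"
proof
  assume "1 - 6 * c\<^sup>2 * of_real u / (omega c z)\<^sup>2 \<in> \<real>\<^sub>\<le>\<^sub>0"
  then obtain x where x: "x \<le> 0" "1 - 6 * c\<^sup>2 * of_real u / (omega c z)\<^sup>2 = complex_of_real x"
    by (auto elim: nonpos_Reals_cases)
  then have "6 * c\<^sup>2 * of_real u = (omega c z)\<^sup>2 * complex_of_real (1 - x)"
    using omega_neq_0[of z] by (simp add: field_simps)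
  then have "(omega c z)\<^sup>2 - 6 * c\<^sup>2 * of_real (u / (1 - x)) = 0"
    using x(1) by (simp add: field_simps flip: of_real_diff)
  then show False
    using R0[of "u / (1 - x)" z] assms x(1) by (simp add: omega_def)
qed

lemma sigma_squared: "(sigma c u z)\<^sup>2 = (omega c z)\<^sup>2 - 6 * c\<^sup>2 * of_real u"
  using omega_neq_0[of z] by (simp add: sigma_def power_mult_distrib field_simps)

text \<open>
  The principal root has nonnegative real part, and a root with real part zero would be the root of a
  number on the closed negative axis.
\<close>

lemma ratio_Re_pos:
  assumes "u \<ge> 0" shows "Re (sigma c u z / omega c z) > 0"
proof -
  let ?t = "1 - 6 * c\<^sup>2 * of_real u / (omega c z)\<^sup>2"
  have nonpos: "s\<^sup>2 \<in> \<real>\<^sub>\<le>\<^sub>0" if "Re s = 0" for s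
    using that by (simp add: complex_nonpos_Reals_iff power2_eq_square)
  have "Re (csqrt ?t) \<noteq> 0"
  proof
    assume "Re (csqrt ?t) = 0"
    from nonpos[OF this] show False unfolding power2_csqrt using root_argument_not_nonpos[OF assms] by blast
  qed
  then have "Re (csqrt ?t) > 0"
    using Re_csqrt[of ?t] by linarith
  then show ?thesis using omega_neq_0[of z] by (simp add: sigma_def)
qed

lemma sigma_neq_0: "u \<ge> 0 \<Longrightarrow> sigma c u z \<noteq> 0"
  using ratio_Re_pos[of u z] by auto

lemma combination_neq_0:
  assumes "u \<ge> 0" "a \<ge> 0" shows "of_real a * omega c z + sigma c u z \<noteq> 0"
proof
  assume "of_real a * omega c z + sigma c u z = 0"
  then have "sigma c u z / omega c z = - of_real a"
    using omega_neq_0[of z] by (simp add: field_simps add_eq_0_iff)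
  then show False using ratio_Re_pos[OF \<open>u \<ge> 0\<close>, of z] \<open>a \<ge> 0\<close> by simp
qed

lemma omega_sigma_neq_0: "u \<ge> 0 \<Longrightarrow> omega c z + sigma c u z \<noteq> 0"
  using combination_neq_0[of u 1 z] by simp

lemma two_omega_sigma_neq_0: "u \<ge> 0 \<Longrightarrow> 2 * omega c z + sigma c u z \<noteq> 0"
  using combination_neq_0[of u 2 z] by simp

text \<open>
  With \<open>6 c\<^sup>2 u = (\<omega> - \<sigma>) (\<omega> + \<sigma>)\<close> the factor \<open>\<omega> - \<sigma>\<close> of \<open>\<omega>\<^sup>3 - \<sigma>\<^sup>3\<close> cancels.
\<close>

lemma profile_eq_psi:
  assumes "u > 0"
  shows "profile c (u, z) = psi c (\<lambda>(u, z). sigma c u z ^ 3) (u, z)"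
proof -
  define w s d where "w = omega c z" and "s = sigma c u z" and "d = c\<^sup>2 * of_real u"
  have d: "6 * d = (w - s) * (w + s)"
    using sigma_squared[of u z] by (simp add: d_def w_def s_def power2_eq_square algebra_simps)
  have "d \<noteq> 0" using c0 assms by (simp add: d_def)
  have "w + s \<noteq> 0" using omega_sigma_neq_0[of u z] assms by (simp add: w_def s_def)
  have "2 / 9 * (2 * w + s)\<^sup>2 / (w + s) = 2 / 3 * w + (w ^ 3 - s ^ 3) / (27 * d)"
  proof -
    have "2 * (2 * w + s)\<^sup>2 * (27 * d) =
        6 * w * ((w + s) * (27 * d)) + 9 * (w ^ 3 - s ^ 3) * (w + s)"
      using d by algebra
    moreover have "s * 9 + w * 9 \<noteq> 0"
      using \<open>w + s \<noteq> 0\<close> by (metis add.commute distrib_right mult_eq_0_iff zero_neq_numeral)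
    ultimately show ?thesis using \<open>d \<noteq> 0\<close> \<open>w + s \<noteq> 0\<close> by (simp add: divide_simps) (simp add: algebra_simps)
  qed
  then show ?thesis
    by (simp add: profile_def psi_def w_def s_def d_def omega_def diff_divide_distrib mult.assoc)
qed

lemma continuous_on_sigma: "continuous_on half_plane (\<lambda>(u, z). sigma c u z)"
proof -
  have W: "continuous_on half_plane (\<lambda>p. omega c (snd p))"
    unfolding omega_def by (intro continuous_intros)
  have arg: "continuous_on half_plane (\<lambda>p. 1 - 6 * c\<^sup>2 * of_real (fst p) / (omega c (snd p))\<^sup>2)"
    using omega_neq_0 by (intro continuous_intros W) auto
  have "continuous_on half_plane (\<lambda>p. csqrt (1 - 6 * c\<^sup>2 * of_real (fst p) / (omega c (snd p))\<^sup>2))"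
    by (rule continuous_on_compose2[OF continuous_on_csqrt arg])
       (use root_argument_not_nonpos in \<open>auto simp: half_plane_def\<close>)
  then show ?thesis unfolding sigma_def case_prod_unfold by (intro continuous_intros W)
qed

lemma is_branch_sigma_cubed: "is_branch c (\<lambda>(u, z). sigma c u z ^ 3)"
proof -
  have "\<exists>l. exp l = radicand c p \<and> (\<lambda>(u, z). sigma c u z ^ 3) p = exp (3 / 2 * l)" if p_in: "p \<in> half_plane" for p
  proof -
    obtain u z where p: "p = (u, z)" "u \<ge> 0"
      using p_in by (cases p) (simp add: half_plane_def)
    have "exp (2 * Ln (sigma c u z)) = radicand c p"
      using sigma_neq_0[OF p(2), of z] sigma_squared[of u z] by (simp add: exp_double p(1) radicand_def omega_def)
    moreover have "sigma c u z ^ 3 = exp (3 / 2 * (2 * Ln (sigma c u z)))"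
      using exp_of_nat_mult[of 3 "Ln (sigma c u z)"] sigma_neq_0[OF p(2), of z] by simp
    ultimately show ?thesis using p(1) by auto
  qed
  moreover have "continuous_on half_plane (\<lambda>(u, z). sigma c u z ^ 3)"
    using continuous_on_sigma unfolding case_prod_unfold by (intro continuous_intros)
  ultimately show ?thesis
    by (simp add: is_branch_def continuous_power_branch_def sigma_def omega_def)
qed

text \<open>
  Each branch of the power \<open>3/2\<close> squares to the cube of the radicand, whatever logarithms it uses.
\<close>

lemma is_branch_unique:
  assumes "is_branch c B" "is_branch c B'" "p \<in> half_plane"
  shows "B' p = B p"
proof (rule continuous_square_roots_agree[where D = half_plane and f = B' and g = B and ?p0.0 = "(0, 0)"])
  have "half_plane = {0..} \<times> (UNIV :: real set)" by (auto simp: half_plane_def)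
  then show "connected half_plane"
    by (metis connected_Times connected_UNIV connected_Ici)
  have sq: "(B p)\<^sup>2 = radicand c p ^ 3 \<and> B p \<noteq> 0" if B: "is_branch c B" "p \<in> half_plane" for B p
  proof -
    obtain l where "exp l = radicand c p" "B p = exp (3 / 2 * l)"
      using B unfolding is_branch_def continuous_power_branch_def by blast
    then show ?thesis
      using exp_of_nat_mult[of 3 l] exp_double[of "3 / 2 * l"] by simp
  qed
  fix p assume "p \<in> half_plane"
  then show "(B' p)\<^sup>2 = (B p)\<^sup>2" "B p \<noteq> 0" using sq assms by auto
qed (use assms in \<open>auto simp: is_branch_def continuous_power_branch_def half_plane_def\<close>)

text \<open>
  The arguments are allowed to be arbitrary expandable functions, so that the lemma serves both the
  profile itself and its substitution instance in \<open>\<phi>\<close>. The sign condition at the centre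
  suffices: the functions involved are holomorphic near the values taken there.
\<close>

lemma expandable_profile:
  assumes U: "expandable_at p (\<lambda>q. complex_of_real (u q))"
    and Z: "expandable_at p (\<lambda>q. complex_of_real (z q))" and "u p \<ge> 0"
  shows "expandable_at p (\<lambda>q. profile c (u q, z q))"
proof -
  have W: "expandable_at p (\<lambda>q. omega c (z q))"
    unfolding omega_def by (intro expandable_add expandable_mult expandable_const Z)
  have inv: "expandable_at p (\<lambda>q. inverse (f q))" if "expandable_at p f" "f p \<noteq> 0" for f
    by (rule expandable_holomorphic_compose[OF that(1), where S = "- {0}" and G = inverse])
       (use that(2) in \<open>auto intro!: holomorphic_intros\<close>)
  have "expandable_at p (\<lambda>q. 1 + (- 6 * c\<^sup>2) * of_real (u q) * (inverse (omega c (z q)) * inverse (omega c (z q))))"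
    by (intro expandable_add expandable_mult expandable_const U inv W omega_neq_0)
  also have "(\<lambda>q. 1 + (- 6 * c\<^sup>2) * of_real (u q) * (inverse (omega c (z q)) * inverse (omega c (z q)))) =
      (\<lambda>q. 1 - 6 * c\<^sup>2 * of_real (u q) / (omega c (z q))\<^sup>2)"
    by (simp add: fun_eq_iff divide_inverse power2_eq_square)
  finally have "expandable_at p (\<lambda>q. csqrt (1 - 6 * c\<^sup>2 * of_real (u q) / (omega c (z q))\<^sup>2))"
    by (rule expandable_holomorphic_compose[where S = "- \<real>\<^sub>\<le>\<^sub>0" and G = csqrt])
       (use root_argument_not_nonpos[OF \<open>u p \<ge> 0\<close>] in \<open>auto intro!: holomorphic_intros simp: open_Compl\<close>)
  then have S: "expandable_at p (\<lambda>q. sigma c (u q) (z q))"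
    unfolding sigma_def by (intro expandable_mult W)
  have "expandable_at p (\<lambda>q. 2 / 9 * ((2 * omega c (z q) + sigma c (u q) (z q)) * (2 * omega c (z q) + sigma c (u q) (z q)))
      * inverse (omega c (z q) + sigma c (u q) (z q)))"
    by (intro expandable_add expandable_mult expandable_const inv W S omega_sigma_neq_0[OF \<open>u p \<ge> 0\<close>])
  then show ?thesis by (simp only: profile_def prod.case power2_eq_square divide_inverse mult.assoc)
qed

lemma profile_real_analytic: "profile c real_analytic_on half_plane"
proof (rule expandable_imp_real_analytic)
  fix p :: "real \<times> real" assume "p \<in> half_plane"
  then have "fst p \<ge> 0" by (auto simp: half_plane_def)
  moreover have "expandable_at p (\<lambda>q. complex_of_real (fst q))"
    using expandable_coordinate[of "(1, 0)" p] by (simp add: Basis_prod_def inner_prod_def)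
  moreover have "expandable_at p (\<lambda>q. complex_of_real (snd q))"
    using expandable_coordinate[of "(0, 1)" p] by (simp add: Basis_prod_def inner_prod_def)
  ultimately show "expandable_at p (profile c)"
    using expandable_profile[of p fst snd] by simp
qed

lemma expandable_component: "expandable_at p (\<lambda>q. complex_of_real ((q :: real ^ 3) $ i))"
  using expandable_coordinate[of "axis i 1" p] by (simp add: inner_axis)

lemma phi_real_analytic: "phi (profile c) real_analytic_on UNIV"
proof (rule expandable_imp_real_analytic)
  fix p :: "real ^ 3"
  have "expandable_at p (\<lambda>q. 1 / 2 * (complex_of_real (q $ 1) * complex_of_real (q $ 1) +
      complex_of_real (q $ 2) * complex_of_real (q $ 2)))"
    by (intro expandable_add expandable_mult expandable_const expandable_component)
  then have "expandable_at p (\<lambda>q. complex_of_real (((q $ 1)\<^sup>2 + (q $ 2)\<^sup>2) / 2))"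
    by (simp add: power2_eq_square)
  then have "expandable_at p (\<lambda>q. profile c (((q $ 1)\<^sup>2 + (q $ 2)\<^sup>2) / 2, q $ 3))"
    by (rule expandable_profile) (auto intro: expandable_component)
  then show "expandable_at p (phi (profile c))"
    unfolding phi_def
    by (intro expandable_add expandable_mult expandable_const expandable_component)
qed

section \<open>First derivatives and semi-conformality\<close>

definition zeta :: "real ^ 3 \<Rightarrow> complex" where
  "zeta p = of_real (p $ 1) + \<i> * of_real (p $ 2)"

abbreviation omega_at :: "real ^ 3 \<Rightarrow> complex" where
  "omega_at p \<equiv> omega c (p $ 3)"

definition sigma_at :: "real ^ 3 \<Rightarrow> complex" where
  "sigma_at p = sigma c (((p $ 1)\<^sup>2 + (p $ 2)\<^sup>2) / 2) (p $ 3)"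

definition profile_at :: "real ^ 3 \<Rightarrow> complex" where
  "profile_at p = 2 / 9 * (2 * omega_at p + sigma_at p)\<^sup>2 / (omega_at p + sigma_at p)"

text \<open>
  The common factor of the derivatives of \<open>profile_at\<close>: the gradient of
  \<open>(2/9) (2 \<omega> + \<sigma>)\<^sup>2 / (\<omega> + \<sigma>)\<close> in \<open>(\<omega>, \<sigma>)\<close> is \<open>(2/9) \<kappa> (2 \<omega> + 3 \<sigma>, \<sigma>)\<close>.
\<close>

definition kappa :: "real ^ 3 \<Rightarrow> complex" where
  "kappa p = (2 * omega_at p + sigma_at p) / (omega_at p + sigma_at p)\<^sup>2"

lemma phi_profile: "phi (profile c) p = zeta p * profile_at p"
  by (simp add: phi_def profile_def zeta_def profile_at_def sigma_at_def)

lemma sigma_at_squared: "(sigma_at p)\<^sup>2 = (omega_at p)\<^sup>2 - 3 * c\<^sup>2 * ((of_real (p $ 1))\<^sup>2 + (of_real (p $ 2))\<^sup>2)"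
  unfolding sigma_at_def sigma_squared by simp

lemma nonzero: "sigma_at p \<noteq> 0" "omega_at p + sigma_at p \<noteq> 0" "2 * omega_at p + sigma_at p \<noteq> 0"
  unfolding sigma_at_def by (auto intro!: sigma_neq_0 omega_sigma_neq_0 two_omega_sigma_neq_0)

lemma component_derivative:
  "((\<lambda>q. complex_of_real ((q :: real ^ 3) $ i)) has_derivative (\<lambda>v. complex_of_real (v $ i))) (at p)"
  by (intro bounded_linear_imp_has_derivative bounded_linear_compose[OF bounded_linear_of_real] bounded_linear_vec_nth)

lemma omega_at_derivative: "(omega_at has_derivative (\<lambda>v. c * of_real (v $ 3))) (at p)"
  unfolding omega_def by (rule derivative_eq_intros component_derivative refl | simp)+

lemma zeta_derivative: "(zeta has_derivative (\<lambda>v. of_real (v $ 1) + \<i> * of_real (v $ 2))) (at p)"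
  unfolding zeta_def by (rule derivative_eq_intros component_derivative refl | simp)+

text \<open>
  Differentials at \<open>p\<close>, applied to the direction \<open>v\<close>. The first one is read off from
  \<open>2 \<sigma> d\<sigma> = d (\<omega>\<^sup>2 - 3 c\<^sup>2 (x\<^sup>2 + y\<^sup>2))\<close>.
\<close>

definition dsigma :: "real ^ 3 \<Rightarrow> real ^ 3 \<Rightarrow> complex" where
  "dsigma p v = (c * omega_at p * of_real (v $ 3)
      - 3 * c\<^sup>2 * (of_real (p $ 1) * of_real (v $ 1) + of_real (p $ 2) * of_real (v $ 2))) / sigma_at p"

definition dprofile :: "real ^ 3 \<Rightarrow> real ^ 3 \<Rightarrow> complex" where
  "dprofile p v = 2 / 3 * kappa p * (c * (omega_at p + sigma_at p) * of_real (v $ 3)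
      - c\<^sup>2 * (of_real (p $ 1) * of_real (v $ 1) + of_real (p $ 2) * of_real (v $ 2)))"

definition dkappa :: "real ^ 3 \<Rightarrow> real ^ 3 \<Rightarrow> complex" where
  "dkappa p v = - (2 * omega_at p * (c * of_real (v $ 3)) + (3 * omega_at p + sigma_at p) * dsigma p v) / (omega_at p + sigma_at p) ^ 3"

lemma sigma_at_derivative:
  "(sigma_at has_derivative dsigma p) (at p)"
proof -
  define X where "X q = 1 - 3 * c\<^sup>2 * ((complex_of_real (q $ 1))\<^sup>2 + (of_real (q $ 2))\<^sup>2) / (omega_at q)\<^sup>2"
    for q :: "real ^ 3"
  have X_inverse: "X q = 1 - 3 * c\<^sup>2 * ((complex_of_real (q $ 1))\<^sup>2 + (of_real (q $ 2))\<^sup>2) * inverse (omega_at q) ^ 2" for q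
    by (simp only: X_def divide_inverse power_inverse)
  have X_eq: "1 - 6 * c\<^sup>2 * of_real (((q $ 1)\<^sup>2 + (q $ 2)\<^sup>2) / 2) / (omega_at q)\<^sup>2 = X q" for q
    by (simp add: X_def)
  have sigma_X: "sigma_at = (\<lambda>q. omega_at q * csqrt (X q))"
    unfolding fun_eq_iff sigma_at_def sigma_def X_eq by blast
  have slitX: "X p \<notin> \<real>\<^sub>\<le>\<^sub>0"
    using root_argument_not_nonpos[of "((p $ 1)\<^sup>2 + (p $ 2)\<^sup>2) / 2" "p $ 3"] unfolding X_eq by simp
  define s where "s = csqrt (X p)"
  have s: "s \<noteq> 0" "s\<^sup>2 = X p" using slitX by (auto simp: s_def)
  let ?x = "complex_of_real (p $ 1)" and ?y = "complex_of_real (p $ 2)" and ?w = "omega_at p"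
  have inv: "((\<lambda>q. inverse (omega_at q)) has_derivative (\<lambda>v. - (inverse ?w * (c * of_real (v $ 3)) * inverse ?w))) (at p)"
    using omega_neq_0 by (rule Deriv.has_derivative_inverse[OF _ omega_at_derivative])
  define i where "i = inverse ?w"
  have "?w * i = 1" using omega_neq_0 by (simp add: i_def)
  have rho: "((\<lambda>q. (complex_of_real (q $ 1))\<^sup>2 + (complex_of_real (q $ 2))\<^sup>2) has_derivative
      (\<lambda>v. 2 * (?x * of_real (v $ 1) + ?y * of_real (v $ 2)))) (at p)"
    by (rule derivative_eq_intros component_derivative refl | simp add: algebra_simps)+
  have inv2: "((\<lambda>q. inverse (omega_at q) ^ 2) has_derivative (\<lambda>v. - 2 * i ^ 3 * (c * of_real (v $ 3)))) (at p)"
    by (rule has_derivative_eq_rhs[OF has_derivative_power[OF inv]])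
       (simp add: fun_eq_iff i_def power3_eq_cube)
  have X': "(X has_derivative (\<lambda>v. - 6 * c\<^sup>2 * i\<^sup>2 * (?x * of_real (v $ 1) + ?y * of_real (v $ 2))
      + 6 * c ^ 3 * i ^ 3 * (?x\<^sup>2 + ?y\<^sup>2) * of_real (v $ 3))) (at p)"
  proof -
    have "(X has_derivative (\<lambda>v. 0 - (3 * c\<^sup>2 * (?x\<^sup>2 + ?y\<^sup>2) * (- 2 * i ^ 3 * (c * of_real (v $ 3)))
        + 3 * c\<^sup>2 * (2 * (?x * of_real (v $ 1) + ?y * of_real (v $ 2))) * i\<^sup>2))) (at p)"
      unfolding X_inverse i_def
      by (intro has_derivative_diff has_derivative_const has_derivative_mult has_derivative_mult_right
          rho inv2[unfolded i_def])
    then show ?thesis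
      by (rule has_derivative_eq_rhs) (simp add: fun_eq_iff algebra_simps power2_eq_square power3_eq_cube)
  qed
  have "(sigma_at has_derivative (\<lambda>v. ?w * ((- 6 * c\<^sup>2 * i\<^sup>2 * (?x * of_real (v $ 1) + ?y * of_real (v $ 2))
      + 6 * c ^ 3 * i ^ 3 * (?x\<^sup>2 + ?y\<^sup>2) * of_real (v $ 3)) / (2 * s)) + c * of_real (v $ 3) * s)) (at p)"
    unfolding sigma_X s_def by (intro has_derivative_mult omega_at_derivative has_derivative_csqrt X' slitX)
  moreover have "?w * ((- 6 * c\<^sup>2 * i\<^sup>2 * a + 6 * c ^ 3 * i ^ 3 * (?x\<^sup>2 + ?y\<^sup>2) * b) / (2 * s)) + c * b * s =
    (c * ?w * b - 3 * c\<^sup>2 * a) / sigma_at p" for a b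
  proof -
    define m where "m = (- 6 * c\<^sup>2 * i\<^sup>2 * a + 6 * c ^ 3 * i ^ 3 * (?x\<^sup>2 + ?y\<^sup>2) * b) / (2 * s)"
    have m: "2 * s * m = - 6 * c\<^sup>2 * i\<^sup>2 * a + 6 * c ^ 3 * i ^ 3 * (?x\<^sup>2 + ?y\<^sup>2) * b"
      using s(1) by (simp add: m_def)
    have s2: "s\<^sup>2 = 1 - 3 * c\<^sup>2 * (?x\<^sup>2 + ?y\<^sup>2) * i\<^sup>2"
      unfolding s(2) X_inverse i_def by simp
    have "2 * ((?w * m + c * b * s) * (?w * s)) = 2 * (c * ?w * b - 3 * c\<^sup>2 * a)"
    proof -
      have "2 * ((?w * m + c * b * s) * (?w * s)) = ?w\<^sup>2 * (2 * s * m) + 2 * c * b * ?w * s\<^sup>2"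
        by (simp add: algebra_simps power2_eq_square)
      also have "\<dots> = - 6 * c\<^sup>2 * a * (?w * i)\<^sup>2 + 6 * c ^ 3 * (?x\<^sup>2 + ?y\<^sup>2) * b * i * (?w * i)\<^sup>2
          + 2 * c * b * ?w - 6 * c ^ 3 * (?x\<^sup>2 + ?y\<^sup>2) * b * i * (?w * i)"
        unfolding m s2 by (simp add: algebra_simps power2_eq_square power3_eq_cube)
      also have "\<dots> = 2 * (c * ?w * b - 3 * c\<^sup>2 * a)"
        unfolding \<open>?w * i = 1\<close> by simp
      finally show ?thesis .
    qed
    then have "(?w * m + c * b * s) * (?w * s) = c * ?w * b - 3 * c\<^sup>2 * a"
      by (simp only: mult_cancel_left) simp
    moreover have "sigma_at p = ?w * s" by (simp add: sigma_X s_def)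
    ultimately show ?thesis
      using s(1) omega_neq_0[of "p $ 3"] unfolding m_def[symmetric] by (simp add: nonzero_eq_divide_eq)
  qed
  ultimately show ?thesis unfolding dsigma_def[abs_def] by (simp only:)
qed

lemma profile_at_derivative: "(profile_at has_derivative dprofile p) (at p)"
proof -
  define dW where "dW v = c * of_real (v $ 3)" for v :: "real ^ 3"
  have W': "(omega_at has_derivative dW) (at p)" unfolding dW_def by (rule omega_at_derivative)
  have num: "((\<lambda>q. 2 / 9 * (2 * omega_at q + sigma_at q)\<^sup>2) has_derivative
      (\<lambda>v. 4 / 9 * (2 * omega_at p + sigma_at p) * (2 * dW v + dsigma p v))) (at p)"
    by (rule derivative_eq_intros W' sigma_at_derivative refl | simp add: algebra_simps add_divide_distrib)+
  have den: "((\<lambda>q. omega_at q + sigma_at q) has_derivative (\<lambda>v. dW v + dsigma p v)) (at p)"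
    by (intro has_derivative_add W' sigma_at_derivative)
  have eq: "(4 / 9 * (2 * omega_at p + sigma_at p) * (2 * dW v + dsigma p v) * (omega_at p + sigma_at p) -
      2 / 9 * (2 * omega_at p + sigma_at p)\<^sup>2 * (dW v + dsigma p v)) / ((omega_at p + sigma_at p) * (omega_at p + sigma_at p)) =
    2 / 3 * kappa p * (c * (omega_at p + sigma_at p) * of_real (v $ 3)
      - c\<^sup>2 * (of_real (p $ 1) * of_real (v $ 1) + of_real (p $ 2) * of_real (v $ 2)))" for v
  proof -
    define a where "a = complex_of_real (p $ 1) * of_real (v $ 1) + of_real (p $ 2) * of_real (v $ 2)"
    define b where "b = complex_of_real (v $ 3)"
    define w t u where "w = omega_at p" and "t = sigma_at p" and "u = omega_at p + sigma_at p"
    have "t * dsigma p v = c * w * b - 3 * c\<^sup>2 * a"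
      using nonzero(1)[of p] by (simp add: dsigma_def a_def b_def w_def t_def)
    then have "2 * (2 * (c * b) + dsigma p v) * u - (2 * w + t) * (c * b + dsigma p v) = 3 * (c * u * b - c\<^sup>2 * a)"
      unfolding u_def w_def[symmetric] t_def[symmetric] by algebra
    then have "4 / 9 * (2 * w + t) * (2 * dW v + dsigma p v) * u - 2 / 9 * (2 * w + t)\<^sup>2 * (dW v + dsigma p v) =
        2 / 3 * (2 * w + t) * (c * u * b - c\<^sup>2 * a)"
      unfolding dW_def b_def[symmetric] by algebra
    then have "(4 / 9 * (2 * w + t) * (2 * dW v + dsigma p v) * u - 2 / 9 * (2 * w + t)\<^sup>2 * (dW v + dsigma p v)) / (u * u) =
        2 / 3 * (2 * w + t) * (c * u * b - c\<^sup>2 * a) / (u * u)"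
      by (rule arg_cong)
    also have "\<dots> = 2 / 3 * ((2 * w + t) / u\<^sup>2) * (c * u * b - c\<^sup>2 * a)"
      by (simp add: power2_eq_square)
    finally show ?thesis unfolding kappa_def a_def b_def u_def w_def t_def .
  qed
  show ?thesis
    unfolding profile_at_def
    by (rule has_derivative_eq_rhs[OF has_derivative_divide'[OF num den nonzero(2)]])
       (rule ext, unfold dprofile_def, rule eq)
qed

lemma kappa_derivative: "(kappa has_derivative dkappa p) (at p)"
proof -
  define dW where "dW v = c * of_real (v $ 3)" for v :: "real ^ 3"
  have W': "(omega_at has_derivative dW) (at p)" unfolding dW_def by (rule omega_at_derivative)
  have num: "((\<lambda>q. 2 * omega_at q + sigma_at q) has_derivative (\<lambda>v. 2 * dW v + dsigma p v)) (at p)"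
    by (rule derivative_eq_intros W' sigma_at_derivative refl | simp)+
  have den: "((\<lambda>q. (omega_at q + sigma_at q)\<^sup>2) has_derivative (\<lambda>v. 2 * (omega_at p + sigma_at p) * (dW v + dsigma p v))) (at p)"
    by (rule derivative_eq_intros W' sigma_at_derivative refl | simp add: algebra_simps)+
  have eq: "((2 * dW v + dsigma p v) * (omega_at p + sigma_at p)\<^sup>2 - (2 * omega_at p + sigma_at p) * (2 * (omega_at p + sigma_at p) * (dW v + dsigma p v)))
        / ((omega_at p + sigma_at p)\<^sup>2 * (omega_at p + sigma_at p)\<^sup>2) =
      - (2 * omega_at p * dW v + (3 * omega_at p + sigma_at p) * dsigma p v) / (omega_at p + sigma_at p) ^ 3" for v
  proof -
    define w t u where "w = omega_at p" and "t = sigma_at p" and "u = omega_at p + sigma_at p"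
    have "u \<noteq> 0" using nonzero(2)[of p] by (simp add: u_def)
    have "(2 * dW v + dsigma p v) * u\<^sup>2 - (2 * w + t) * (2 * u * (dW v + dsigma p v)) =
        u * (- (2 * w * dW v + (3 * w + t) * dsigma p v))"
      unfolding u_def w_def[symmetric] t_def[symmetric] by algebra
    then have "((2 * dW v + dsigma p v) * u\<^sup>2 - (2 * w + t) * (2 * u * (dW v + dsigma p v))) / (u\<^sup>2 * u\<^sup>2) =
        u * (- (2 * w * dW v + (3 * w + t) * dsigma p v)) / (u * u ^ 3)"
      by (simp only: power2_eq_square power3_eq_cube mult.assoc)
    also have "\<dots> = - (2 * w * dW v + (3 * w + t) * dsigma p v) / u ^ 3"
      using \<open>u \<noteq> 0\<close> by (rule nonzero_mult_divide_mult_cancel_left)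
    finally show ?thesis unfolding u_def w_def t_def .
  qed
  have "(omega_at p + sigma_at p)\<^sup>2 \<noteq> 0" using nonzero(2)[of p] by simp
  note quot = has_derivative_divide'[OF num den this]
  show ?thesis
    unfolding kappa_def
    by (rule has_derivative_eq_rhs[OF quot]) (rule ext, unfold dkappa_def dW_def[symmetric], rule eq)
qed

lemma phi_derivative:
  "(phi (profile c) has_derivative
      (\<lambda>v. zeta p * dprofile p v + (of_real (v $ 1) + \<i> * of_real (v $ 2)) * profile_at p)) (at p)"
proof -
  have "phi (profile c) = (\<lambda>p. zeta p * profile_at p)" by (rule ext) (rule phi_profile)
  then show ?thesis using has_derivative_mult[OF zeta_derivative profile_at_derivative] by simp
qed

lemma axis_components:
  "axis (1 :: 3) (1 :: real) $ 1 = 1" "axis (1 :: 3) (1 :: real) $ 2 = 0" "axis (1 :: 3) (1 :: real) $ 3 = 0"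
  "axis (2 :: 3) (1 :: real) $ 1 = 0" "axis (2 :: 3) (1 :: real) $ 2 = 1" "axis (2 :: 3) (1 :: real) $ 3 = 0"
  "axis (3 :: 3) (1 :: real) $ 1 = 0" "axis (3 :: 3) (1 :: real) $ 2 = 0" "axis (3 :: 3) (1 :: real) $ 3 = 1"
  by (simp_all add: axis_def)

lemma partials:
  "partial_deriv 1 (phi (profile c)) p = profile_at p - 2 / 3 * c\<^sup>2 * (of_real (p $ 1) * (zeta p * kappa p))"
  "partial_deriv 2 (phi (profile c)) p = \<i> * profile_at p - 2 / 3 * c\<^sup>2 * (of_real (p $ 2) * (zeta p * kappa p))"
  "partial_deriv 3 (phi (profile c)) p = 2 / 3 * c * (zeta p * (kappa p * (omega_at p + sigma_at p)))"
  unfolding partial_deriv_eq[OF phi_derivative] dprofile_def axis_components by simp_all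

text \<open>
  Because \<open>1 + \<i>\<^sup>2 = 0\<close> the terms with \<open>\<psi>\<^sup>2\<close> cancel in the sum of squares. The mixed terms produce another
  factor \<open>\<zeta>\<close>, after which everything is a multiple of \<open>\<zeta>\<^sup>2 \<kappa>\<^sup>2\<close>.
\<close>

lemma semi_conformal_phi: "semi_conformal (phi (profile c))"
  unfolding semi_conformal_def
proof
  show "phi (profile c) differentiable_on UNIV"
    using phi_derivative by (auto simp: differentiable_on_def differentiable_def)
  show "\<forall>p. (partial_deriv 1 (phi (profile c)) p)\<^sup>2 + (partial_deriv 2 (phi (profile c)) p)\<^sup>2 +
      (partial_deriv 3 (phi (profile c)) p)\<^sup>2 = 0"
  proof
    fix p :: "real ^ 3"
    define w t k z x y where "w = omega_at p" and "t = sigma_at p" and "k = kappa p" and "z = zeta p"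
      and "x = complex_of_real (p $ 1)" and "y = complex_of_real (p $ 2)"
    have z: "z = x + \<i> * y" by (simp add: z_def x_def y_def zeta_def)
    have t: "3 * c\<^sup>2 * (x\<^sup>2 + y\<^sup>2) = (w - t) * (w + t)"
      using sigma_at_squared[of p] by (simp add: w_def t_def x_def y_def power2_eq_square algebra_simps)
    have "w + t \<noteq> 0" using nonzero(2)[of p] by (simp add: w_def t_def)
    then have profile_eq: "profile_at p = 2 / 9 * (k * (2 * w + t) * (w + t))"
      by (simp add: profile_at_def k_def kappa_def w_def[symmetric] t_def[symmetric] power2_eq_square)
    have "(profile_at p - 2 / 3 * c\<^sup>2 * (x * (z * k)))\<^sup>2 + (\<i> * profile_at p - 2 / 3 * c\<^sup>2 * (y * (z * k)))\<^sup>2 +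
        (2 / 3 * c * (z * (k * (w + t))))\<^sup>2 =
      - 4 / 3 * c\<^sup>2 * z * k * profile_at p * (x + \<i> * y) + 4 / 9 * c ^ 4 * z\<^sup>2 * k\<^sup>2 * (x\<^sup>2 + y\<^sup>2)
        + 4 / 9 * c\<^sup>2 * z\<^sup>2 * k\<^sup>2 * (w + t)\<^sup>2"
      by (simp add: power2_eq_square power4_eq_xxxx algebra_simps add_divide_distrib)
    also have "\<dots> = 4 / 27 * c\<^sup>2 * z\<^sup>2 * k\<^sup>2 *
        (3 * c\<^sup>2 * (x\<^sup>2 + y\<^sup>2) + 3 * (w + t)\<^sup>2 - 2 * (2 * w + t) * (w + t))"
      unfolding profile_eq z[symmetric]
      by (simp add: power2_eq_square power4_eq_xxxx algebra_simps add_divide_distrib)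
    also have "\<dots> = 0" unfolding t by (simp add: power2_eq_square algebra_simps)
    finally show "(partial_deriv 1 (phi (profile c)) p)\<^sup>2 + (partial_deriv 2 (phi (profile c)) p)\<^sup>2 +
      (partial_deriv 3 (phi (profile c)) p)\<^sup>2 = 0"
      unfolding partials w_def t_def k_def z_def x_def y_def .
  qed
qed

section \<open>The Laplacian at one point\<close>

text \<open>
  The Laplacian vanishes on the axis \<open>x = y = 0\<close> because of the factor \<open>\<zeta>\<close>. The point \<open>(1, 0, 0)\<close> is
  off the axis and makes \<open>\<omega> = \<zeta> = 1\<close>, so that everything becomes a rational expression in the value \<open>s\<close>
  of \<open>\<sigma>\<close>, with \<open>3 c\<^sup>2 = 1 - s\<^sup>2\<close>.
\<close>

lemma not_harmonic_phi: "\<not> harmonic (phi (profile c))"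
proof
  assume harm: "harmonic (phi (profile c))"
  let ?q = "axis 1 1 :: real ^ 3"
  let ?d = "\<lambda>v :: real ^ 3. complex_of_real (v $ 1) + \<i> * of_real (v $ 2)"
  have zK: "((\<lambda>p. zeta p * kappa p) has_derivative (\<lambda>v. zeta p * dkappa p v + ?d v * kappa p)) (at p)" for p
    by (intro has_derivative_mult zeta_derivative kappa_derivative)
  have xzK: "((\<lambda>p. complex_of_real (p $ i) * (zeta p * kappa p)) has_derivative
      (\<lambda>v. of_real (p $ i) * (zeta p * dkappa p v + ?d v * kappa p) + of_real (v $ i) * (zeta p * kappa p))) (at p)" for p i
    by (intro has_derivative_mult component_derivative zK)
  define s where "s = sigma_at ?q"
  have omega_q: "omega_at ?q = 1" "omega c 0 = 1" and z: "zeta ?q = 1" by (simp_all add: omega_def zeta_def axis_components)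
  have s: "s \<noteq> 0" "1 + s \<noteq> 0" "2 + s \<noteq> 0" using nonzero[of ?q] unfolding s_def omega_q by simp_all
  have s2: "3 * c\<^sup>2 = 1 - s\<^sup>2" using sigma_at_squared[of ?q] unfolding s_def omega_q axis_components by simp
  \<comment> \<open>With names for the two reciprocals the remaining computation is polynomial.\<close>
  define r v where "r = inverse s" and "v = inverse (1 + s)"
  have rv: "s * r = 1" "(1 + s) * v = 1" using s by (simp_all add: r_def v_def)
  have div_s: "a / s = a * r" and div_u: "a / (1 + s) ^ n = a * v ^ n" for a :: complex and n
    by (simp_all only: r_def v_def divide_inverse power_inverse)
  have kappa_q: "kappa ?q = (2 + s) * v\<^sup>2" unfolding kappa_def omega_q s_def[symmetric] div_u by simp
  have p1: "partial_deriv 1 (phi (profile c)) = (\<lambda>p. profile_at p - 2 / 3 * c\<^sup>2 * (of_real (p $ 1) * (zeta p * kappa p)))"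
    by (rule ext) (rule partials)
  have "((\<lambda>p. profile_at p - 2 / 3 * c\<^sup>2 * (of_real (p $ 1) * (zeta p * kappa p))) has_derivative
      (\<lambda>v. dprofile ?q v - 2 / 3 * c\<^sup>2 * (of_real (?q $ 1) * (zeta ?q * dkappa ?q v + ?d v * kappa ?q)
        + of_real (v $ 1) * (zeta ?q * kappa ?q)))) (at ?q)"
    by (intro has_derivative_diff has_derivative_mult_right profile_at_derivative xzK)
  from partial_deriv_eq[OF this, of 1]
  have xx: "partial_deriv 1 (partial_deriv 1 (phi (profile c))) ?q =
      dprofile ?q (axis 1 1) - 2 / 3 * c\<^sup>2 * (dkappa ?q (axis 1 1) + 2 * kappa ?q)"
    unfolding p1 axis_components z by simp
  have p2: "partial_deriv 2 (phi (profile c)) = (\<lambda>p. \<i> * profile_at p - 2 / 3 * c\<^sup>2 * (of_real (p $ 2) * (zeta p * kappa p)))"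
    by (rule ext) (rule partials)
  have "((\<lambda>p. \<i> * profile_at p - 2 / 3 * c\<^sup>2 * (of_real (p $ 2) * (zeta p * kappa p))) has_derivative
      (\<lambda>v. \<i> * dprofile ?q v - 2 / 3 * c\<^sup>2 * (of_real (?q $ 2) * (zeta ?q * dkappa ?q v + ?d v * kappa ?q)
        + of_real (v $ 2) * (zeta ?q * kappa ?q)))) (at ?q)"
    by (intro has_derivative_diff has_derivative_mult_right profile_at_derivative xzK)
  from partial_deriv_eq[OF this, of 2]
  have yy: "partial_deriv 2 (partial_deriv 2 (phi (profile c))) ?q =
      \<i> * dprofile ?q (axis 2 1) - 2 / 3 * c\<^sup>2 * kappa ?q"
    unfolding p2 axis_components z by simp
  have p3: "partial_deriv 3 (phi (profile c)) = (\<lambda>p. 2 / 3 * c * (zeta p * (kappa p * (omega_at p + sigma_at p))))"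
    by (rule ext) (rule partials)
  have "((\<lambda>p. 2 / 3 * c * (zeta p * (kappa p * (omega_at p + sigma_at p)))) has_derivative
      (\<lambda>v. 2 / 3 * c * (zeta ?q * (kappa ?q * (c * of_real (v $ 3) + dsigma ?q v) + dkappa ?q v * (omega_at ?q + sigma_at ?q))
        + ?d v * (kappa ?q * (omega_at ?q + sigma_at ?q))))) (at ?q)"
    by (intro has_derivative_mult_right has_derivative_mult has_derivative_add
        zeta_derivative kappa_derivative omega_at_derivative sigma_at_derivative)
  from partial_deriv_eq[OF this, of 3]
  have zz: "partial_deriv 3 (partial_deriv 3 (phi (profile c))) ?q =
      2 / 3 * c * (kappa ?q * (c + dsigma ?q (axis 3 1)) + dkappa ?q (axis 3 1) * (1 + s))"
    unfolding p3 axis_components z omega_q s_def by simp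
  have dT1: "dsigma ?q (axis 1 1) = - (1 - s\<^sup>2) * r"
    unfolding dsigma_def axis_components s_def[symmetric] div_s s2 by simp
  have dK1: "dkappa ?q (axis 1 1) = (3 + s) * ((1 - s\<^sup>2) * r) * v ^ 3"
    unfolding dkappa_def dT1 axis_components omega_q s_def[symmetric] div_u by (simp add: algebra_simps)
  have dT3: "dsigma ?q (axis 3 1) = c * r"
    unfolding dsigma_def axis_components omega_q s_def[symmetric] div_s by simp
  have dK3: "dkappa ?q (axis 3 1) = - (2 * c + (3 + s) * (c * r)) * v ^ 3"
    unfolding dkappa_def dT3 axis_components omega_q s_def[symmetric] div_u by simp
  have dprofile_q: "dprofile ?q (axis 1 1) = - 2 / 3 * c\<^sup>2 * kappa ?q" "dprofile ?q (axis 2 1) = 0"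
    unfolding dprofile_def axis_components by simp_all
  have "0 = partial_deriv 1 (partial_deriv 1 (phi (profile c))) ?q +
      partial_deriv 2 (partial_deriv 2 (phi (profile c))) ?q +
      partial_deriv 3 (partial_deriv 3 (phi (profile c))) ?q"
    using harm unfolding harmonic_def by metis
  also have "\<dots> = - 2 / 3 * c\<^sup>2 * (4 * ((2 + s) * v\<^sup>2) + (3 + s) * ((1 - s\<^sup>2) * r) * v ^ 3
      - (2 + s) * v\<^sup>2 * (1 + r) + (2 + (3 + s) * r) * v ^ 3 * (1 + s))"
    unfolding xx yy zz dprofile_q dK1 dK3 dT3 kappa_q
    by (simp add: algebra_simps power2_eq_square add_divide_distrib)
  also have "4 * ((2 + s) * v\<^sup>2) + (3 + s) * ((1 - s\<^sup>2) * r) * v ^ 3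
      - (2 + s) * v\<^sup>2 * (1 + r) + (2 + (3 + s) * r) * v ^ 3 * (1 + s) = 2 * (2 + s) * r * v"
  proof -
    have "v\<^sup>2 = (1 + s) * v * v\<^sup>2" unfolding rv(2) by simp
    then have v2: "v\<^sup>2 = (1 + s) * v ^ 3" by (simp add: power2_eq_square power3_eq_cube)
    have "4 * ((2 + s) * v\<^sup>2) + (3 + s) * ((1 - s\<^sup>2) * r) * v ^ 3
        - (2 + s) * v\<^sup>2 * (1 + r) + (2 + (3 + s) * r) * v ^ 3 * (1 + s) =
      v ^ 3 * (1 + s) * ((4 * (2 + s) - (2 + s) + 2) * (s * r) + (3 + s) * (1 - s) * r - (2 + s) * r + (3 + s) * r)"
      unfolding v2 rv(1) by (simp add: algebra_simps power2_eq_square)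
    also have "\<dots> = 2 * (2 + s) * r * v * ((1 + s) * v)\<^sup>2"
      by (simp add: algebra_simps power2_eq_square power3_eq_cube)
    finally show ?thesis unfolding rv(2) by simp
  qed
  finally have "0 = - 2 / 3 * c\<^sup>2 * (2 * (2 + s) * r * v)" .
  moreover have "r \<noteq> 0" "v \<noteq> 0" using rv by auto
  moreover have "2 * (2 + s) \<noteq> 0" using s(3) by (simp only: mult_eq_0_iff) simp
  ultimately show False using c0 by simp
qed

end

theorem mainTheorem3:
  fixes c :: complex
  assumes "c \<noteq> 0"
    and "\<And>z :: real. 1 + c * of_real z \<noteq> 0"
    and "\<And>u z :: real. u \<ge> 0 \<Longrightarrow> (1 + c * of_real z)\<^sup>2 - 6 * c\<^sup>2 * of_real u \<noteq> 0"
  shows "\<exists>B. is_branch c B \<and> (\<forall>B'. is_branch c B' \<longrightarrow> (\<forall>p\<in>half_plane. B' p = B p)) \<and>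
    (\<exists>\<Psi> :: real \<times> real \<Rightarrow> complex.
       (\<forall>u z. u > 0 \<longrightarrow> \<Psi> (u, z) = psi c B (u, z)) \<and>
       \<Psi> real_analytic_on half_plane \<and>
       phi \<Psi> real_analytic_on UNIV \<and>
       semi_conformal (phi \<Psi>) \<and>
       \<not> harmonic (phi \<Psi>))"
proof -
  interpret admissible c by unfold_locales (use assms in auto)
  show ?thesis
  proof (intro exI conjI)
    show "is_branch c (\<lambda>(u, z). sigma c u z ^ 3)" by (rule is_branch_sigma_cubed)
    show "\<forall>B'. is_branch c B' \<longrightarrow> (\<forall>p\<in>half_plane. B' p = (\<lambda>(u, z). sigma c u z ^ 3) p)"
      using is_branch_unique[OF is_branch_sigma_cubed] by blast
    show "\<forall>u z. u > 0 \<longrightarrow> profile c (u, z) = psi c (\<lambda>(u, z). sigma c u z ^ 3) (u, z)"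
      using profile_eq_psi by blast
  qed (rule profile_real_analytic phi_real_analytic semi_conformal_phi not_harmonic_phi)+
qed

end
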